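(* Let $q, p \in \mathbb{N}$ with $q \geq p$, and let $x^0 \in \mathbb{R}^n$. Let $f : \mathbb{R}^n \to \mathbb{R}$ have a max-representation of order $q$, and assume that the sublevel set $\{ x \in \mathbb{R}^n : f(x) \leq f(x^0) \}$ is bounded. Let $(x^j)_j$ be the sequence generated by the trust-region bundle method (described in the context) with initial point $x^0$, model order $q$, exponent $p$, vanishing sequences $(\Delta_j)_j, (\tau_j)_j \subseteq \mathbb{R}^{>0}$, and parameters $\sigma \in (0,1)$, $c > 0$. Then $\Lambda^p(x^j,\Delta_j) \to 0$ as $j \to \infty$. Furthermore, $(x^j)_j$ has an accumulation point, and all accumulation points of $(x^j)_j$ are critical points of $f$.
   Context: Notation: $\mathbb{N} = \{1,2,\dots\}$, $\|\cdot\|$ is the Euclidean norm, $\bar{B}_\Delta(x) = \{ y \in \mathbb{R}^n : \| y - x \| \leq \Delta \}$. A sequence in $\mathbb{R}^{>0}$ is vanishing if it converges to $0$. Max-representation of order $q$: there are a (nonempty) compact topological space $S$ and $(q+1)$-times continuously differentiable functions $f_s : \mathbb{R}^n \to \mathbb{R}$, $s \in S$ (selection functions), such that $f(x) = \max_{s \in S} f_s(x)$ for all $x \in \mathbb{R}^n$, and $f_s(x)$ and all partial derivatives of $f_s$ at $x$ up to order $q+1$ depend continuously on $(s,x) \in S \times \mathbb{R}^n$. The active set at $x$ is $A(x) = \{ s \in S : f_s(x) = f(x) \}$. Such an $f$ is locally Lipschitz continuous with Clarke subdifferential $\partial f(x) = \mathrm{conv}(\{ \nabla f_s(x) : s \in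 A(x) \})$; $x$ is a critical point of $f$ if $0 \in \partial f(x)$. For $x \in \mathbb{R}^n$, $\Delta > 0$, $p \in \mathbb{N}$: $\Lambda^p(x,\Delta) = \dfrac{f(x) - f(z^*(x,\Delta))}{\Delta^p}$, where $z^*(x,\Delta) \in \arg\min_{z \in \bar{B}_\Delta(x)} f(z)$. Oracle: for each $x \in \mathbb{R}^n$ one has the value $f(x)$ and, for some $s(x) \in A(x)$, the derivatives up to order $q$ of $f_{s(x)}$ at $x$. The Taylor polynomial of order $q$ of $f_s$ at $y$ is $T^q f_s(z,y) = \sum_{m=0}^q \frac{1}{m!} D^m f_s(y)(z-y)^m$, where $D^0 f_s(y)(v)^0 = f_s(y)$ and $D^m f_s(y)(v)^m = \sum_{i_1=1}^n \cdots \sum_{i_m=1}^n \partial_{i_1}\cdots\partial_{i_m} f_s(y) v_{i_1}\cdots v_{i_m}$. For a nonempty finite set $W \subseteq \mathbb{R}^n$, the $q$-order cutting-plane model is $\mathcal{T}^{q,W}(z) = \max_{y \in W} T^q f_{s(y)}(z,y)$. Let $\bar{z}^{q,W}(x,\Delta)$ denote a solution of $\min_{z \in \bar{B}_\Delta(x)} \mathcal{T}^{q,W}(z)$. Subroutine (computation of $W$) for input $x$, $\Delta > 0$, and a finite nonempty $W^1 \subseteq \bar{B}_\Delta(x)$, with parameters $\sigma \in (0,1)$, $c > 0$: for $i = 1,2,\dots$, compute $\bar{z}^{W^i} = \bar{z}^{q,W^i}(x,\Delta)$; if $f(\bar{z}^{W^i}) - \mathcal{T}^{q,W^i}(\bar{z}^{W^i})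 \leq \min(\Delta^{q+\sigma}, c)$, stop and return $W = W^i$; otherwise set $W^{i+1} = W^i \cup \{\bar{z}^{W^i}\}$. (It is known that this subroutine terminates for every $x$ and $\Delta$.) Trust-region bundle method: Given the initial point $x^{1,0} = x^0$, vanishing sequences $(\Delta_j)_j, (\tau_j)_j \subseteq \mathbb{R}^{>0}$, $p, q \in \mathbb{N}$, $\sigma \in (0,1)$, $c > 0$. For $j = 1,2,\dots$: for $i = 0,1,\dots$: compute $W_{j,i} \subseteq \bar{B}_{\Delta_j}(x^{j,i})$ via the subroutine with input $x = x^{j,i}$, $\Delta = \Delta_j$, $W^1 = \{x^{j,i}\}$, and set $\bar{z}^{j,i} = \bar{z}^{q,W_{j,i}}(x^{j,i},\Delta_j)$ (the solution for which the stopping criterion of the subroutine holds); if $(f(x^{j,i}) - f(\bar{z}^{j,i}))/\Delta_j^p < \tau_j$, break the $i$-loop, otherwise set $x^{j,i+1} = \bar{z}^{j,i}$. After the $i$-loop is broken, set $x^{j+1,0} = x^{j,i}$ and $x^j = x^{j,i}$ (for the last index $i$). *)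

theory Defs
  imports "HOL-Analysis.Analysis"
begin

definition partial_deriv :: "'n::finite \<Rightarrow> (real^'n \<Rightarrow> real) \<Rightarrow> real^'n \<Rightarrow> real" where
  "partial_deriv i g x = deriv (\<lambda>t. g (x + t *\<^sub>R axis i 1)) 0"

fun iter_partial :: "'n::finite list \<Rightarrow> (real^'n \<Rightarrow> real) \<Rightarrow> real^'n \<Rightarrow> real" where
  "iter_partial [] g = g"
| "iter_partial (i # is) g = partial_deriv i (iter_partial is g)"

definition gradient :: "(real^'n::finite \<Rightarrow> real) \<Rightarrow> real^'n \<Rightarrow> real^'n" where
  "gradient g x = (\<chi> i. partial_deriv i g x)"

(* Derivatives of order below k exist in the Frechet sense; together with continuity up to
   order k this is the usual C^k condition. *)
definition continuously_differentiable :: "nat \<Rightarrow> (real^'n::finite \<Rightarrow> real) \<Rightarrow> bool" where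
  "continuously_differentiable k g \<longleftrightarrow>
     (\<forall>is. length is < k \<longrightarrow> (\<forall>x. iter_partial is g differentiable (at x))) \<and>
     (\<forall>is. length is \<le> k \<longrightarrow> continuous_on UNIV (iter_partial is g))"

definition max_representation ::
  "nat \<Rightarrow> 's topology \<Rightarrow> ('s \<Rightarrow> real^'n::finite \<Rightarrow> real) \<Rightarrow> (real^'n \<Rightarrow> real) \<Rightarrow> bool" where
  "max_representation q S F f \<longleftrightarrow>
     compact_space S \<and> topspace S \<noteq> {} \<and>
     (\<forall>s\<in>topspace S. continuously_differentiable (q + 1) (F s)) \<and>
     (\<forall>x. (\<exists>s\<in>topspace S. f x = F s x) \<and> (\<forall>s\<in>topspace S. F s x \<le> f x)) \<and>
     (\<forall>is. length is \<le> q + 1 \<longrightarrow>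
        continuous_map (prod_topology S euclidean) euclideanreal
          (\<lambda>(s, x). iter_partial is (F s) x))"

definition active_set ::
  "'s topology \<Rightarrow> ('s \<Rightarrow> real^'n::finite \<Rightarrow> real) \<Rightarrow> (real^'n \<Rightarrow> real) \<Rightarrow> real^'n \<Rightarrow> 's set" where
  "active_set S F f x = {s \<in> topspace S. F s x = f x}"

(* Clarke's generalized directional derivative and subdifferential. For functions with a
   max-representation the subdifferential is the convex hull of the active gradients,
   see clarke_subdifferential_max_representation below. *)

definition clarke_dir_deriv :: "(real^'n::finite \<Rightarrow> real) \<Rightarrow> real^'n \<Rightarrow> real^'n \<Rightarrow> ereal" where
  "clarke_dir_deriv f x v =
     Limsup (nhds x \<times>\<^sub>F at_right 0) (\<lambda>(y, t). ereal ((f (y + t *\<^sub>R v) - f y) / t))"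

definition clarke_subdifferential :: "(real^'n::finite \<Rightarrow> real) \<Rightarrow> real^'n \<Rightarrow> (real^'n) set" where
  "clarke_subdifferential f x = {\<xi>. \<forall>v. ereal (\<xi> \<bullet> v) \<le> clarke_dir_deriv f x v}"

lemma partial_deriv_eq:
  assumes "(g has_derivative g') (at x)"
  shows "partial_deriv i g x = g' (axis i 1)"
proof -
  have l: "((\<lambda>t::real. x + t *\<^sub>R axis i 1) has_derivative (\<lambda>t. t *\<^sub>R axis i 1)) (at 0)"
    by (auto intro!: derivative_eq_intros)
  have "(g has_derivative g') (at (x + 0 *\<^sub>R axis i 1))"
    using assms by simp
  from has_derivative_compose[OF l this]
  have "((\<lambda>t. g (x + t *\<^sub>R axis i 1)) has_derivative (\<lambda>t. g' (t *\<^sub>R axis i 1))) (at 0)" .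
  moreover have "g' (t *\<^sub>R axis i 1) = g' (axis i 1) * t" for t
    using linear_scale[OF has_derivative_linear[OF assms], of t "axis i 1"] by simp
  ultimately show ?thesis
    unfolding partial_deriv_def by (intro DERIV_imp_deriv) (simp add: has_field_derivative_def)
qed

lemma has_derivative_gradient:
  fixes g :: "real^'n::finite \<Rightarrow> real"
  assumes "g differentiable (at x)"
  shows "(g has_derivative (\<lambda>h. gradient g x \<bullet> h)) (at x)"
proof -
  from assms obtain g' where g': "(g has_derivative g') (at x)"
    unfolding differentiable_def by blast
  have "g' h = gradient g x \<bullet> h" for h
  proof -
    have lin: "linear g'" using g' by (rule has_derivative_linear)
    have "g' h = g' (\<Sum>i\<in>UNIV. (h $ i) *\<^sub>R axis i 1)"
      using basis_expansion[of h] by (simp add: scalar_mult_eq_scaleR)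
    also have "\<dots> = (\<Sum>i\<in>UNIV. h $ i * g' (axis i 1))"
      using lin by (simp add: linear_sum linear_scale)
    also have "\<dots> = gradient g x \<bullet> h"
      by (simp add: inner_vec_def gradient_def partial_deriv_eq[OF g'] mult.commute)
    finally show ?thesis .
  qed
  then have "g' = (\<lambda>h. gradient g x \<bullet> h)" by blast
  with g' show ?thesis by simp
qed

lemma has_real_derivative_along_line:
  fixes g :: "real^'n::finite \<Rightarrow> real"
  assumes "\<And>y. g differentiable (at y)"
  shows "((\<lambda>t. g (y + t *\<^sub>R v)) has_real_derivative (gradient g (y + t *\<^sub>R v) \<bullet> v)) (at t)"
proof -
  have l: "((\<lambda>t::real. y + t *\<^sub>R v) has_derivative (\<lambda>t. t *\<^sub>R v)) (at t)"
    by (auto intro!: derivative_eq_intros)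
  from has_derivative_compose[OF l has_derivative_gradient[OF assms]]
  show ?thesis
    by (simp add: has_field_derivative_def mult.commute[of _ "gradient g (y + t *\<^sub>R v) \<bullet> v"])
qed

lemma clarke_subdifferential_max_representation:
  fixes F :: "'s \<Rightarrow> real^'n::finite \<Rightarrow> real"
  assumes rep: "max_representation q S F f"
  shows "clarke_subdifferential f x =
    convex hull ((\<lambda>s. gradient (F s) x) ` active_set S F f x)"
proof -
  define A where "A = active_set S F f x"
  define K where "K = (\<lambda>s. gradient (F s) x) ` A"
  have cS: "compact_space S"
    and att: "\<And>y. \<exists>s\<in>topspace S. f y = F s y"
    and le: "\<And>s y. s \<in> topspace S \<Longrightarrow> F s y \<le> f y"
    using rep by (auto simp: max_representation_def)
  have diff: "F s differentiable (at y)" if "s \<in> topspace S" for s y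
  proof -
    have "continuously_differentiable (q + 1) (F s)"
      using rep that by (auto simp: max_representation_def)
    then show ?thesis
      unfolding continuously_differentiable_def by (metis iter_partial.simps(1) list.size(3) add_gr_0 less_one)
  qed
  have line: "((\<lambda>t. F s (y + t *\<^sub>R v)) has_real_derivative (gradient (F s) (y + t *\<^sub>R v) \<bullet> v)) (at t)"
    if "s \<in> topspace S" for s y v t
    by (rule has_real_derivative_along_line) (use diff that in blast)
  have contF: "continuous_map (prod_topology S euclidean) euclideanreal (\<lambda>(s, x). F s x)"
    using rep unfolding max_representation_def by (elim conjE) (drule spec[of _ "[]"], simp)
  have contP: "continuous_map (prod_topology S euclidean) euclideanreal
      (\<lambda>(s, x). partial_deriv i (F s) x)" for i
  proof -
    have "continuous_map (prod_topology S euclidean) euclideanreal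
      (\<lambda>(s, x). iter_partial [i] (F s) x)"
      using rep unfolding max_representation_def by (elim conjE) (drule spec[of _ "[i]"], simp)
    then show ?thesis by simp
  qed
  have contG: "continuous_map (prod_topology S euclidean) euclideanreal
      (\<lambda>(s, y). gradient (F s) y \<bullet> v)" for v
  proof -
    have "continuous_map (prod_topology S euclidean) euclideanreal
      (\<lambda>w. \<Sum>i\<in>UNIV. (case w of (s, y) \<Rightarrow> partial_deriv i (F s) y) * v $ i)"
      by (intro continuous_map_sum continuous_map_real_mult contP) auto
    then show ?thesis
      by (simp add: inner_vec_def gradient_def case_prod_unfold)
  qed
  have slice: "continuous_map S (prod_topology S euclidean) (\<lambda>s. (s, y))" for y :: "real^'n"
    by (intro continuous_map_pairedI) (auto simp: continuous_map_const)
  have contFs: "continuous_map S euclideanreal (\<lambda>s. F s x)"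
    using continuous_map_compose[OF slice contF] by (simp add: o_def)
  have contK: "continuous_map S euclidean (\<lambda>s. gradient (F s) x)"
  proof -
    have 1: "continuous_map S euclideanreal (\<lambda>s. partial_deriv i (F s) x)" for i
      using continuous_map_compose[OF slice contP] by (simp add: o_def)
    show ?thesis
      unfolding continuous_map_atin limitin_canonical_iff
    proof
      fix s assume s: "s \<in> topspace S"
      show "((\<lambda>s. gradient (F s) x) \<longlongrightarrow> gradient (F s) x) (atin S s)"
        by (rule vec_tendstoI)
           (use 1 s in \<open>simp add: gradient_def continuous_map_atin limitin_canonical_iff\<close>)
    qed
  qed
  have Asub: "A \<subseteq> topspace S" by (auto simp: A_def active_set_def)
  have "closedin S {s \<in> topspace S. F s x \<in> {f x}}"
    using closedin_continuous_map_preimage[OF contFs, of "{f x}"] by simp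
  then have "compactin S A"
    using closedin_compact_space[OF cS] by (simp add: A_def active_set_def)
  then have "compact K"
    using image_compactin[OF _ contK] by (simp add: K_def)
  then have clK: "closed (convex hull K)"
    by (intro compact_imp_closed compact_convex_hull)
  have K0: "K \<noteq> {}"
    using att[of x] by (auto simp: K_def A_def active_set_def)

  have lower: "ereal (k \<bullet> v) \<le> clarke_dir_deriv f x v" if "k \<in> K" for k v
  proof (rule ccontr)
    assume "\<not> ?thesis"
    then have "clarke_dir_deriv f x v < ereal (k \<bullet> v)" by simp
    then obtain b where b: "clarke_dir_deriv f x v < b" "b < ereal (k \<bullet> v)"
      using dense by blast
    from that obtain s where s: "s \<in> topspace S" "F s x = f x" and k: "k = gradient (F s) x"
      by (auto simp: K_def A_def active_set_def)
    have "\<forall>\<^sub>F (y, t) in nhds x \<times>\<^sub>F at_right 0. ereal ((f (y + t *\<^sub>R v) - f y) / t) < b"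
      using Limsup_lessD[OF b(1)[unfolded clarke_dir_deriv_def]] by (simp add: case_prod_unfold)
    then obtain P Q where PQ: "eventually P (nhds x)" "eventually Q (at_right (0::real))"
      "\<And>y t. P y \<Longrightarrow> Q t \<Longrightarrow> ereal ((f (y + t *\<^sub>R v) - f y) / t) < b"
      unfolding eventually_prod_filter by auto
    have "P x" using PQ(1) eventually_nhds_x_imp_x by blast
    have lim: "((\<lambda>t. (F s (x + t *\<^sub>R v) - F s x) / t) \<longlongrightarrow> k \<bullet> v) (at_right 0)"
      using line[OF s(1), of x v 0] unfolding has_field_derivative_iff k
      by (auto intro: tendsto_within_subset)
    have "\<forall>\<^sub>F t in at_right 0. ereal ((F s (x + t *\<^sub>R v) - F s x) / t) \<le> b"
      using PQ(2) eventually_at_right_less[of 0]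
    proof eventually_elim
      case (elim t)
      have "(F s (x + t *\<^sub>R v) - F s x) / t \<le> (f (x + t *\<^sub>R v) - f x) / t"
        using elim le[OF s(1), of "x + t *\<^sub>R v"] s(2) by (intro divide_right_mono) auto
      then show ?case using PQ(3)[OF \<open>P x\<close> elim(1)]
        by (meson ereal_less_eq(3) less_le_trans order.strict_trans1 order_less_imp_le)
    qed
    moreover have "((\<lambda>t. ereal ((F s (x + t *\<^sub>R v) - F s x) / t)) \<longlongrightarrow> ereal (k \<bullet> v)) (at_right 0)"
      using lim by simp
    ultimately have "ereal (k \<bullet> v) \<le> b"
      using tendsto_upperbound trivial_limit_at_right_real by blast
    then show False using b(2) by simp
  qed

  have upper: "clarke_dir_deriv f x v \<le> ereal B" if B: "\<And>k. k \<in> K \<Longrightarrow> k \<bullet> v < B" for v B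
  proof -
    from att[of x] obtain s0 where s0: "s0 \<in> topspace S" "f x = F s0 x" by blast
    let ?T = "prod_topology S (euclidean :: ((real^'n) \<times> (real^'n)) topology)"
    define O1 where "O1 = {w \<in> topspace ?T. gradient (F (fst w)) (fst (snd w)) \<bullet> v \<in> {..<B}}"
    define O2 where "O2 = {w \<in> topspace ?T. F (fst w) (snd (snd w)) - F s0 (snd (snd w)) \<in> {..<0}}"
    have c0: "continuous_map ?T S fst" and cs: "continuous_map ?T euclidean snd"
      by (rule continuous_map_fst continuous_map_snd)+
    have c1: "continuous_map ?T euclidean (\<lambda>w. fst (snd w))"
      and c2: "continuous_map ?T euclidean (\<lambda>w. snd (snd w))"
      using continuous_map_compose[OF cs, of euclidean fst]
        continuous_map_compose[OF cs, of euclidean snd]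
      by (auto simp: o_def continuous_on_fst continuous_on_snd)
    have p1: "continuous_map ?T (prod_topology S euclidean) (\<lambda>w. (fst w, fst (snd w)))"
      and p2: "continuous_map ?T (prod_topology S euclidean) (\<lambda>w. (fst w, snd (snd w)))"
      and p3: "continuous_map ?T (prod_topology S euclidean) (\<lambda>w. (s0, snd (snd w)))"
      using s0(1) c0 c1 c2 by (auto intro!: continuous_map_pairedI simp: continuous_map_const)
    have "openin ?T O1" unfolding O1_def
      using continuous_map_compose[OF p1 contG[of v]]
      by (intro openin_continuous_map_preimage[where Y=euclideanreal]) (auto simp: o_def)
    moreover have "openin ?T O2" unfolding O2_def
      using continuous_map_compose[OF p2 contF] continuous_map_compose[OF p3 contF]
      by (intro openin_continuous_map_preimage[where Y=euclideanreal] continuous_map_diff)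
         (auto simp: o_def)
    ultimately have op: "openin ?T (O1 \<union> O2)" by blast
    have sub: "topspace S \<times> {(x, x)} \<subseteq> O1 \<union> O2"
    proof
      fix w assume "w \<in> topspace S \<times> {(x, x)}"
      then obtain s where w: "w = (s, x, x)" and s: "s \<in> topspace S" by auto
      show "w \<in> O1 \<union> O2"
      proof (cases "s \<in> A")
        case True
        then show ?thesis using B[of "gradient (F s) x"] s by (auto simp: O1_def w K_def)
      next
        case False
        then have "F s x < F s0 x"
          using le[OF s, of x] s s0 by (auto simp: A_def active_set_def)
        then show ?thesis using s by (auto simp: O2_def w)
      qed
    qed
    from tube_lemma_left[OF op cS[unfolded compact_space_def] _ sub] obtain V where
      V: "open V" "(x, x) \<in> V" "topspace S \<times> V \<subseteq> O1 \<union> O2"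
      by (metis (no_types, lifting) Sigma_mono UNIV_I open_openin order_refl order_trans topspace_euclidean)
    from V(1,2) obtain V1 V2 where V12: "open V1" "open V2" "x \<in> V1" "x \<in> V2" "V1 \<times> V2 \<subseteq> V"
      by (metis SigmaE2 open_prod_elim mem_Sigma_iff)
    have "open (V1 \<inter> V2)" "x \<in> V1 \<inter> V2" using V12 by auto
    then obtain e where e: "e > 0" "ball x e \<subseteq> V1 \<inter> V2"
      by (meson open_contains_ball)
    have key: "(f (y + t *\<^sub>R v) - f y) / t \<le> B"
      if y: "y \<in> ball x e" and yt: "y + t *\<^sub>R v \<in> ball x e" and t: "t > 0" for y t
    proof -
      from att[of "y + t *\<^sub>R v"] obtain s
        where s: "s \<in> topspace S" "f (y + t *\<^sub>R v) = F s (y + t *\<^sub>R v)" by blast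
      obtain r where r: "0 < r" "r < t" "F s (y + t *\<^sub>R v) - F s (y + 0 *\<^sub>R v)
          = (t - 0) * (gradient (F s) (y + r *\<^sub>R v) \<bullet> v)"
        using MVT2[OF t, of "\<lambda>t. F s (y + t *\<^sub>R v)" "\<lambda>t. gradient (F s) (y + t *\<^sub>R v) \<bullet> v"]
          line[OF s(1)] by blast
      have "y + r *\<^sub>R v = (1 - r / t) *\<^sub>R y + (r / t) *\<^sub>R (y + t *\<^sub>R v)"
        using t by (simp add: algebra_simps)
      also have "\<dots> \<in> ball x e"
        using r t y yt by (intro convexD[OF convex_ball]) auto
      finally have "(y + r *\<^sub>R v, y + t *\<^sub>R v) \<in> V"
        using yt e(2) V12(5) by blast
      then have "(s, y + r *\<^sub>R v, y + t *\<^sub>R v) \<in> O1 \<union> O2"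
        using V(3) s(1) by blast
      moreover have "(s, y + r *\<^sub>R v, y + t *\<^sub>R v) \<notin> O2"
        using le[OF s0(1), of "y + t *\<^sub>R v"] s(2) by (auto simp: O2_def)
      ultimately have "gradient (F s) (y + r *\<^sub>R v) \<bullet> v < B"
        by (auto simp: O1_def)
      then have "F s (y + t *\<^sub>R v) - F s y \<le> t * B"
        using r(3) t by simp
      then have "f (y + t *\<^sub>R v) - f y \<le> B * t"
        using le[OF s(1), of y] s(2) by (simp add: mult.commute)
      then show ?thesis using t by (simp add: divide_le_eq)
    qed
    have "((\<lambda>w. fst w + snd w *\<^sub>R v) \<longlongrightarrow> x + 0 *\<^sub>R v) (nhds x \<times>\<^sub>F at_right 0)"
      by (intro tendsto_intros filterlim_fst tendsto_compose_filtermap[unfolded o_def]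
          filterlim_mono[OF filterlim_snd _ order_refl])
         (auto simp: at_within_def)
    then have e2: "\<forall>\<^sub>F w in nhds x \<times>\<^sub>F at_right 0. fst w + snd w *\<^sub>R v \<in> ball x e"
      using e(1) by (intro topological_tendstoD) auto
    have e1: "\<forall>\<^sub>F w in nhds x \<times>\<^sub>F at_right (0::real). fst w \<in> ball x e"
      using e(1) by (intro topological_tendstoD[OF filterlim_fst]) auto
    have e3: "\<forall>\<^sub>F w in nhds x \<times>\<^sub>F at_right (0::real). snd w > 0"
      using eventually_at_right_less[of 0]
      by (intro eventually_prodI[where P = "\<lambda>_. True", simplified, THEN eventually_mono]) auto
    show ?thesis
      unfolding clarke_dir_deriv_def
    proof (rule Limsup_bounded)
      show "\<forall>\<^sub>F w in nhds x \<times>\<^sub>F at_right 0.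
        (case w of (y, t) \<Rightarrow> ereal ((f (y + t *\<^sub>R v) - f y) / t)) \<le> ereal B"
        using e1 e2 e3 by eventually_elim (auto simp: key)
    qed
  qed

  show ?thesis
    unfolding A_def[symmetric] K_def[symmetric]
  proof (intro set_eqI iffI)
    fix \<xi> assume \<xi>: "\<xi> \<in> clarke_subdifferential f x"
    show "\<xi> \<in> convex hull K"
    proof (rule ccontr)
      assume "\<xi> \<notin> convex hull K"
      from separating_hyperplane_closed_point[OF convex_convex_hull clK this]
      obtain a b where ab: "a \<bullet> \<xi> < b" "\<And>k. k \<in> convex hull K \<Longrightarrow> b < a \<bullet> k" by blast
      have "clarke_dir_deriv f x (- a) \<le> ereal (- b)"
        using ab(2)[OF hull_inc] by (intro upper) (auto simp: inner_commute)
      moreover have "ereal (\<xi> \<bullet> (- a)) \<le> clarke_dir_deriv f x (- a)"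
        using \<xi> unfolding clarke_subdifferential_def by blast
      ultimately have "ereal (\<xi> \<bullet> (- a)) \<le> ereal (- b)" by (rule order_trans[rotated])
      then show False using ab(1) by (simp add: inner_commute)
    qed
  next
    fix \<xi> assume \<xi>: "\<xi> \<in> convex hull K"
    have "ereal (\<xi> \<bullet> v) \<le> clarke_dir_deriv f x v" for v
    proof (rule ccontr)
      assume "\<not> ?thesis"
      then have lt: "clarke_dir_deriv f x v < ereal (\<xi> \<bullet> v)" by simp
      have "K \<subseteq> {k. v \<bullet> k < \<xi> \<bullet> v}"
        using lower[of _ v] lt by (force simp: inner_commute dest: le_less_trans)
      then have "convex hull K \<subseteq> {k. v \<bullet> k < \<xi> \<bullet> v}"
        by (intro hull_minimal convex_halfspace_lt)
      then show False using \<xi> by (auto simp: inner_commute)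
    qed
    then show "\<xi> \<in> clarke_subdifferential f x"
      by (simp add: clarke_subdifferential_def)
  qed
qed

definition critical_point :: "(real^'n::finite \<Rightarrow> real) \<Rightarrow> real^'n \<Rightarrow> bool" where
  "critical_point f x \<longleftrightarrow> 0 \<in> clarke_subdifferential f x"

(* The value does not depend on which minimizer arg_min_on selects. *)
definition Lambda :: "(real^'n::finite \<Rightarrow> real) \<Rightarrow> nat \<Rightarrow> real^'n \<Rightarrow> real \<Rightarrow> real" where
  "Lambda f p x \<Delta> = (f x - f (arg_min_on f (cball x \<Delta>))) / \<Delta> ^ p"

definition higher_deriv :: "nat \<Rightarrow> (real^'n::finite \<Rightarrow> real) \<Rightarrow> real^'n \<Rightarrow> real^'n \<Rightarrow> real" where
  "higher_deriv m g y v = (\<Sum>is\<in>{is. length is = m}. iter_partial is g y * (\<Prod>i\<leftarrow>is. v $ i))"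

definition taylor :: "nat \<Rightarrow> (real^'n::finite \<Rightarrow> real) \<Rightarrow> real^'n \<Rightarrow> real^'n \<Rightarrow> real" where
  "taylor q g z y = (\<Sum>m=0..q. 1 / fact m * higher_deriv m g y (z - y))"

(* The oracle is a fixed map orc assigning to each point y the active index s(y). *)
definition cutting_plane_model ::
  "('s \<Rightarrow> real^'n::finite \<Rightarrow> real) \<Rightarrow> (real^'n \<Rightarrow> 's) \<Rightarrow> nat \<Rightarrow> (real^'n) set \<Rightarrow> real^'n \<Rightarrow> real" where
  "cutting_plane_model F orc q W z = Max ((\<lambda>y. taylor q (F (orc y)) z y) ` W)"

definition model_solution ::
  "('s \<Rightarrow> real^'n::finite \<Rightarrow> real) \<Rightarrow> (real^'n \<Rightarrow> 's) \<Rightarrow> nat \<Rightarrow> (real^'n) set \<Rightarrow> real^'n \<Rightarrow> real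
    \<Rightarrow> real^'n \<Rightarrow> bool" where
  "model_solution F orc q W x \<Delta> z \<longleftrightarrow>
     is_arg_min (cutting_plane_model F orc q W) (\<lambda>z. z \<in> cball x \<Delta>) z"

definition model_accurate ::
  "('s \<Rightarrow> real^'n::finite \<Rightarrow> real) \<Rightarrow> (real^'n \<Rightarrow> real) \<Rightarrow> (real^'n \<Rightarrow> 's) \<Rightarrow> nat \<Rightarrow> real \<Rightarrow> real
    \<Rightarrow> (real^'n) set \<Rightarrow> real \<Rightarrow> real^'n \<Rightarrow> bool" where
  "model_accurate F f orc q \<sigma> c W \<Delta> z \<longleftrightarrow>
     f z - cutting_plane_model F orc q W z \<le> min (\<Delta> powr (real q + \<sigma>)) c"

(* subroutine F f orc q \<sigma> c x \<Delta> W1 W z: the computation of W, started from W1, may stop and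
   return W, with z the solution of the model problem for W at which the stopping criterion
   holds. It is a relation because model solutions need not be unique: any solution may be
   picked whenever one is computed. *)
inductive subroutine ::
  "('s \<Rightarrow> real^'n::finite \<Rightarrow> real) \<Rightarrow> (real^'n \<Rightarrow> real) \<Rightarrow> (real^'n \<Rightarrow> 's) \<Rightarrow> nat \<Rightarrow> real \<Rightarrow> real
    \<Rightarrow> real^'n \<Rightarrow> real \<Rightarrow> (real^'n) set \<Rightarrow> (real^'n) set \<Rightarrow> real^'n \<Rightarrow> bool"
  for F f orc q \<sigma> c x \<Delta> where
  stop: "model_solution F orc q W x \<Delta> z \<Longrightarrow> model_accurate F f orc q \<sigma> c W \<Delta> z
    \<Longrightarrow> subroutine F f orc q \<sigma> c x \<Delta> W W z"
| extend: "model_solution F orc q W1 x \<Delta> z1 \<Longrightarrow> \<not> model_accurate F f orc q \<sigma> c W1 \<Delta> z1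
    \<Longrightarrow> subroutine F f orc q \<sigma> c x \<Delta> (W1 \<union> {z1}) W z
    \<Longrightarrow> subroutine F f orc q \<sigma> c x \<Delta> W1 W z"

definition break_at ::
  "(real^'n::finite \<Rightarrow> real) \<Rightarrow> nat \<Rightarrow> (nat \<Rightarrow> real) \<Rightarrow> (nat \<Rightarrow> real) \<Rightarrow> (nat \<Rightarrow> nat \<Rightarrow> real^'n)
    \<Rightarrow> (nat \<Rightarrow> nat \<Rightarrow> real^'n) \<Rightarrow> nat \<Rightarrow> nat \<Rightarrow> bool" where
  "break_at f p \<Delta> \<tau> x z j i \<longleftrightarrow> (f (x j i) - f (z j i)) / \<Delta> j ^ p < \<tau> j"

(* The doubly indexed families x, W, z record a run of the method, with the outer loop
   counted from j = 1 (entries for j = 0 are irrelevant). For each j only the indices i up to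
   the first break are constrained. It is not assumed that a break occurs. *)
definition trust_region_bundle_run ::
  "('s \<Rightarrow> real^'n::finite \<Rightarrow> real) \<Rightarrow> (real^'n \<Rightarrow> real) \<Rightarrow> (real^'n \<Rightarrow> 's) \<Rightarrow> nat \<Rightarrow> nat \<Rightarrow> real \<Rightarrow> real
    \<Rightarrow> (nat \<Rightarrow> real) \<Rightarrow> (nat \<Rightarrow> real) \<Rightarrow> real^'n \<Rightarrow> (nat \<Rightarrow> nat \<Rightarrow> real^'n)
    \<Rightarrow> (nat \<Rightarrow> nat \<Rightarrow> (real^'n) set) \<Rightarrow> (nat \<Rightarrow> nat \<Rightarrow> real^'n) \<Rightarrow> bool" where
  "trust_region_bundle_run F f orc q p \<sigma> c \<Delta> \<tau> x0 x W z \<longleftrightarrow>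
     x 1 0 = x0 \<and>
     (\<forall>j\<ge>1. \<forall>i. (\<forall>k<i. \<not> break_at f p \<Delta> \<tau> x z j k) \<longrightarrow>
        subroutine F f orc q \<sigma> c (x j i) (\<Delta> j) {x j i} (W j i) (z j i) \<and>
        (if break_at f p \<Delta> \<tau> x z j i then x (Suc j) 0 = x j i else x j (Suc i) = z j i))"

definition last_index ::
  "(real^'n::finite \<Rightarrow> real) \<Rightarrow> nat \<Rightarrow> (nat \<Rightarrow> real) \<Rightarrow> (nat \<Rightarrow> real) \<Rightarrow> (nat \<Rightarrow> nat \<Rightarrow> real^'n)
    \<Rightarrow> (nat \<Rightarrow> nat \<Rightarrow> real^'n) \<Rightarrow> nat \<Rightarrow> nat" where
  "last_index f p \<Delta> \<tau> x z j = (LEAST i. break_at f p \<Delta> \<tau> x z j i)"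

definition accumulation_point :: "(nat \<Rightarrow> 'a::topological_space) \<Rightarrow> 'a \<Rightarrow> bool" where
  "accumulation_point X l \<longleftrightarrow> (\<exists>r. strict_mono r \<and> (X \<circ> r) \<longlonglongrightarrow> l)"

end

theory Submission
  imports Defs
begin

text \<open>The Taylor polynomials of order \<open>q\<close> of the selection functions have a remainder bounded by
  \<open>C \<parallel>z - y\<parallel>\<^sup>q\<^sup>+\<^sup>1\<close> on bounded sets, with one \<open>C\<close> for all \<open>s \<in> S\<close> because \<open>S\<close> is compact
  (\<open>uniform_taylor_error\<close>). Since \<open>f\<close> dominates every selection function, a cutting-plane model with
  nodes in a ball of radius \<open>\<Delta>\<close> exceeds \<open>f\<close> there by at most \<open>C (2 \<Delta>)\<^sup>q\<^sup>+\<^sup>1\<close>. When the subroutine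
  stops, the value of \<open>f\<close> at the model minimizer is above the model minimum by at most
  \<open>\<Delta>\<^sup>q\<^sup>+\<^sup>\<sigma>\<close>, so this point minimizes \<open>f\<close> over the ball up to \<open>\<Delta>\<^sup>q\<^sup>+\<^sup>\<sigma> + C (2 \<Delta>)\<^sup>q\<^sup>+\<^sup>1\<close>
  (\<open>subroutine_nearly_minimizes\<close>).

  Each inner step without break lowers \<open>f\<close> by at least \<open>\<tau>\<^sub>j \<Delta>\<^sub>j\<^sup>p\<close>, whereas \<open>f\<close> is bounded below on
  the compact initial sublevel set; so every inner loop breaks, and all iterates stay in that set. The
  break says that the model minimizer gains less than \<open>\<tau>\<^sub>j \<Delta>\<^sub>j\<^sup>p\<close>, and near-optimality turns this into
  \<open>\<Lambda>\<^sup>p(x\<^sup>j, \<Delta>\<^sub>j) \<le> \<tau>\<^sub>j + \<Delta>\<^sub>j\<^sup>q\<^sup>-\<^sup>p\<^sup>+\<^sup>\<sigma> + C 2\<^sup>q\<^sup>+\<^sup>1 \<Delta>\<^sub>j\<^sup>q\<^sup>-\<^sup>p\<^sup>+\<^sup>1\<close>, which vanishes because \<open>q \<ge> p\<close>.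

  Finally, a vanishing \<open>\<Lambda>\<^sup>p\<close> forces criticality of the accumulation points straight from Clarke's
  definition (\<open>critical_point_if_decrease_vanishes\<close>): near a non-critical point, \<open>f\<close> can be decreased
  on every small ball by a fixed multiple of the radius.\<close>

section \<open>Taylor's formula with a uniform remainder\<close>

lemma finite_lists_of_length: "finite {is :: 'n::finite list. length is = m}"
  using finite_lists_length_eq[of "UNIV :: 'n set" m] by simp

lemma sum_lists_of_Suc_length:
  fixes h :: "'n::finite list \<Rightarrow> 'a::comm_monoid_add"
  shows "(\<Sum>is\<in>{is. length is = Suc m}. h is) = (\<Sum>is\<in>{is. length is = m}. \<Sum>i\<in>UNIV. h (i # is))"
proof -
  have "bij_betw (\<lambda>(is, i). i # is) ({is :: 'n list. length is = m} \<times> UNIV) {is. length is = Suc m}"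
    by (rule bij_betwI[where g = "\<lambda>is. (tl is, hd is)"]) (auto simp: length_Suc_conv)
  then show ?thesis
    by (simp add: sum.reindex_bij_betw[symmetric] sum.cartesian_product case_prod_unfold)
qed

text \<open>The sum over index lists in \<^const>\<open>higher_deriv\<close> is built so that differentiating
  \<open>D\<^sup>m g (y + t v) v\<^sup>m\<close> in \<open>t\<close> puts one more index in front of each list.\<close>

lemma higher_deriv_along_line:
  assumes "continuously_differentiable k g" and "m < k"
  shows "((\<lambda>t. higher_deriv m g (y + t *\<^sub>R v) v) has_real_derivative
    higher_deriv (Suc m) g (y + t *\<^sub>R v) v) (at t)"
proof -
  have "((\<lambda>t. higher_deriv m g (y + t *\<^sub>R v) v) has_real_derivative
    (\<Sum>is\<in>{is. length is = m}. gradient (iter_partial is g) (y + t *\<^sub>R v) \<bullet> v * (\<Prod>i\<leftarrow>is. v $ i))) (at t)"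
    unfolding higher_deriv_def
  proof (intro DERIV_sum DERIV_cmult_right has_real_derivative_along_line)
    fix "is" :: "'a list" and u
    assume "is \<in> {is. length is = m}"
    then show "iter_partial is g differentiable (at u)"
      using assms by (auto simp: continuously_differentiable_def)
  qed
  then show ?thesis
    by (simp add: higher_deriv_def sum_lists_of_Suc_length gradient_def inner_vec_def
        sum_distrib_right mult.assoc)
qed

lemma taylor_lagrange_remainder:
  assumes "continuously_differentiable (Suc k) g"
  obtains t where "0 < t" and "t < 1"
    and "g z - taylor k g z y = higher_deriv (Suc k) g (y + t *\<^sub>R (z - y)) (z - y) / fact (Suc k)"
proof -
  define d where "d m t = higher_deriv m g (y + t *\<^sub>R (z - y)) (z - y)" for m t
  have "\<forall>m t. m < Suc k \<and> 0 \<le> t \<and> t \<le> 1 \<longrightarrow> (d m has_real_derivative d (Suc m) t) (at t)"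
    using higher_deriv_along_line[OF assms, of _ y "z - y"] by (simp add: d_def[abs_def])
  from Maclaurin[OF zero_less_one zero_less_Suc refl this]
  obtain t where t: "0 < t" "t < 1"
    and eq: "d 0 1 = (\<Sum>m<Suc k. d m 0 / fact m * 1 ^ m) + d (Suc k) t / fact (Suc k) * 1 ^ Suc k"
    by blast
  have "d 0 1 = g z"
    by (simp add: d_def higher_deriv_def)
  moreover have "(\<Sum>m<Suc k. d m 0 / fact m * 1 ^ m) = taylor k g z y"
    unfolding taylor_def by (rule sum.cong) (auto simp: d_def)
  ultimately show thesis
    using that[OF t] eq by (simp add: d_def)
qed

lemma abs_higher_deriv_le:
  "\<bar>higher_deriv m g y v\<bar> \<le> (\<Sum>is\<in>{is. length is = m}. \<bar>iter_partial is g y\<bar>) * norm v ^ m"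
proof -
  have prod: "\<bar>\<Prod>i\<leftarrow>is. v $ i\<bar> \<le> norm v ^ length is" for "is"
    by (induction "is") (auto simp: abs_mult intro!: mult_mono component_le_norm_cart)
  have "\<bar>higher_deriv m g y v\<bar> \<le> (\<Sum>is\<in>{is. length is = m}. \<bar>iter_partial is g y * (\<Prod>i\<leftarrow>is. v $ i)\<bar>)"
    unfolding higher_deriv_def by (rule sum_abs)
  also have "\<dots> \<le> (\<Sum>is\<in>{is. length is = m}. \<bar>iter_partial is g y\<bar> * norm v ^ m)"
    using prod by (intro sum_mono) (auto simp: abs_mult intro!: mult_left_mono)
  finally show ?thesis
    by (simp add: sum_distrib_right)
qed

lemma max_representation_iter_partial_bounded:
  assumes rep: "max_representation q S F f" and len: "length is \<le> q + 1" and K: "compact K"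
  obtains M where "\<And>s x. s \<in> topspace S \<Longrightarrow> x \<in> K \<Longrightarrow> \<bar>iter_partial is (F s) x\<bar> \<le> M"
proof -
  have "continuous_map (prod_topology S euclidean) euclideanreal (\<lambda>(s, x). iter_partial is (F s) x)"
    using rep len by (simp add: max_representation_def)
  moreover have "compactin (prod_topology S euclidean) (topspace S \<times> K)"
    using rep K by (simp add: max_representation_def compactin_Times compact_space_def)
  ultimately have "compact ((\<lambda>(s, x). iter_partial is (F s) x) ` (topspace S \<times> K))"
    using image_compactin by fastforce
  from compact_imp_bounded[OF this] obtain M
    where "\<forall>u \<in> (\<lambda>(s, x). iter_partial is (F s) x) ` (topspace S \<times> K). norm u \<le> M"
    by (auto simp: bounded_iff)
  then show thesis
    by (intro that[of M]) auto
qed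

text \<open>Compactness of \<open>S\<close> makes the remainder estimate independent of the selection function; this
  uniformity is what lets a single constant serve all the models built along a run.\<close>

lemma uniform_taylor_error:
  fixes F :: "'s \<Rightarrow> real^'n::finite \<Rightarrow> real"
  assumes rep: "max_representation q S F f" and "k \<le> q"
  obtains C where "C \<ge> 0"
    and "\<And>s y z. s \<in> topspace S \<Longrightarrow> y \<in> cball 0 R \<Longrightarrow> z \<in> cball 0 R
      \<Longrightarrow> \<bar>F s z - taylor k (F s) z y\<bar> \<le> C * norm (z - y) ^ Suc k"
proof -
  have "\<exists>M. \<forall>s\<in>topspace S. \<forall>x\<in>cball 0 R. \<bar>iter_partial is (F s) x\<bar> \<le> M"
    if "length is = Suc k" for "is"
  proof -
    have "length is \<le> q + 1" using that \<open>k \<le> q\<close> by simp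
    from max_representation_iter_partial_bounded[OF rep this compact_cball] show ?thesis by metis
  qed
  then obtain M where M: "\<And>is s x. length is = Suc k \<Longrightarrow> s \<in> topspace S \<Longrightarrow> x \<in> cball 0 R
      \<Longrightarrow> \<bar>iter_partial is (F s) x\<bar> \<le> M is"
    by metis
  define C where "C = (\<Sum>is\<in>{is. length is = Suc k}. \<bar>M is\<bar>)"
  show thesis
  proof
    show "C \<ge> 0" by (simp add: C_def sum_nonneg)
  next
    fix s and y z :: "real^'n"
    assume s: "s \<in> topspace S" and y: "y \<in> cball 0 R" and z: "z \<in> cball 0 R"
    have "continuously_differentiable (q + 1) (F s)"
      using rep s by (simp add: max_representation_def)
    then have "continuously_differentiable (Suc k) (F s)"
      using \<open>k \<le> q\<close> by (auto simp: continuously_differentiable_def)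
    then obtain t where t: "0 < t" "t < 1" and rem: "F s z - taylor k (F s) z y
        = higher_deriv (Suc k) (F s) (y + t *\<^sub>R (z - y)) (z - y) / fact (Suc k)"
      by (rule taylor_lagrange_remainder)
    have "(1 - t) *\<^sub>R y + t *\<^sub>R z \<in> cball 0 R"
      using t y z by (intro convexD[OF convex_cball]) auto
    then have w: "y + t *\<^sub>R (z - y) \<in> cball 0 R"
      by (simp add: algebra_simps)
    have "\<bar>F s z - taylor k (F s) z y\<bar> \<le> \<bar>higher_deriv (Suc k) (F s) (y + t *\<^sub>R (z - y)) (z - y)\<bar>"
      unfolding rem abs_divide using mult_left_mono[OF fact_ge_1[of "Suc k", where 'a = real] abs_ge_zero]
      by (simp add: divide_le_eq)
    also have "\<dots> \<le> C * norm (z - y) ^ Suc k"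
    proof (rule order_trans[OF abs_higher_deriv_le], rule mult_right_mono)
      show "(\<Sum>is\<in>{is. length is = Suc k}. \<bar>iter_partial is (F s) (y + t *\<^sub>R (z - y))\<bar>) \<le> C"
        unfolding C_def using M[OF _ s w] by (intro sum_mono) (auto intro: order_trans[OF _ abs_ge_self])
    qed simp
    finally show "\<bar>F s z - taylor k (F s) z y\<bar> \<le> C * norm (z - y) ^ Suc k" .
  qed
qed

section \<open>Minimizers on balls\<close>

text \<open>The remainder estimate of order \<open>0\<close> says that the selection functions share a Lipschitz
  constant on each ball, and their maximum inherits it.\<close>

lemma max_representation_continuous:
  fixes F :: "'s \<Rightarrow> real^'n::finite \<Rightarrow> real"
  assumes rep: "max_representation q S F f"
  shows "continuous_on UNIV f"
proof -
  have "continuous_on (ball 0 R) f" for R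
  proof -
    obtain C where C: "C \<ge> 0" "\<And>s y z. s \<in> topspace S \<Longrightarrow> y \<in> cball 0 R \<Longrightarrow> z \<in> cball 0 R
        \<Longrightarrow> \<bar>F s z - taylor 0 (F s) z y\<bar> \<le> C * norm (z - y) ^ Suc 0"
      using uniform_taylor_error[OF rep le0] by metis
    have *: "f z - f y \<le> C * norm (z - y)" if yz: "y \<in> ball 0 R" "z \<in> ball 0 R" for y z
    proof -
      obtain s where s: "s \<in> topspace S" "f z = F s z" and "F s y \<le> f y"
        using rep unfolding max_representation_def by metis
      moreover have "taylor 0 (F s) z y = F s y"
        by (simp add: taylor_def higher_deriv_def)
      ultimately show ?thesis
        using C(2)[OF s(1), of y z] yz by auto
    qed
    have "dist (f y) (f z) \<le> C * dist y z" if "y \<in> ball 0 R" "z \<in> ball 0 R" for y z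
      using *[OF that] *[OF that(2,1)] by (simp add: dist_norm norm_minus_commute abs_le_iff)
    then show ?thesis
      using C(1) by (intro lipschitz_on_continuous_on[of C] lipschitz_onI)
  qed
  then have "continuous_on (\<Union>R\<in>UNIV. ball 0 R) f"
    by (intro continuous_on_open_UN) auto
  moreover have "(\<Union>R\<in>UNIV. ball (0 :: real^'n) R) = UNIV"
    by (auto intro: gt_ex)
  ultimately show ?thesis by simp
qed

lemma arg_min_on_compact:
  fixes f :: "'a::topological_space \<Rightarrow> real"
  assumes "compact K" and "K \<noteq> {}" and "continuous_on K f"
  shows "arg_min_on f K \<in> K" and "\<And>y. y \<in> K \<Longrightarrow> f (arg_min_on f K) \<le> f y"
proof -
  have "\<exists>y. is_arg_min f (\<lambda>y. y \<in> K) y"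
    using continuous_attains_inf[OF assms] by (auto simp: is_arg_min_linorder)
  then have "is_arg_min f (\<lambda>y. y \<in> K) (arg_min_on f K)"
    unfolding arg_min_on_def arg_min_def by (rule someI_ex)
  then show "arg_min_on f K \<in> K" "\<And>y. y \<in> K \<Longrightarrow> f (arg_min_on f K) \<le> f y"
    by (auto simp: is_arg_min_linorder)
qed

section \<open>Accuracy of the cutting-plane model\<close>

lemma subroutine_result:
  assumes "subroutine F f orc q \<sigma> c x \<Delta> W1 W z"
    and "finite W1" and "W1 \<noteq> {}" and "W1 \<subseteq> cball x \<Delta>"
  shows "finite W \<and> W \<noteq> {} \<and> W \<subseteq> cball x \<Delta> \<and>
    model_solution F orc q W x \<Delta> z \<and> model_accurate F f orc q \<sigma> c W \<Delta> z"
  using assms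
proof (induction rule: subroutine.induct)
  case (extend W1 z1 W z)
  then show ?case by (auto simp: model_solution_def is_arg_min_def)
qed simp

text \<open>Each Taylor polynomial overshoots its selection function, hence \<open>f\<close>, by at most the remainder,
  so the model minimum nearly underestimates the minimum of \<open>f\<close>. The stopping criterion
  bounds \<open>f z\<close> by the model minimum.\<close>

lemma subroutine_nearly_minimizes:
  fixes F :: "'s \<Rightarrow> real^'n::finite \<Rightarrow> real"
  assumes rep: "max_representation q S F f" and orc: "\<And>y. orc y \<in> active_set S F f y"
    and sub: "subroutine F f orc q \<sigma> c x \<Delta> {x} W z" and "\<Delta> > 0"
    and "C \<ge> 0" and C: "\<And>s y z. s \<in> topspace S \<Longrightarrow> y \<in> cball x \<Delta> \<Longrightarrow> z \<in> cball x \<Delta>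
      \<Longrightarrow> \<bar>F s z - taylor q (F s) z y\<bar> \<le> C * norm (z - y) ^ Suc q"
    and u: "u \<in> cball x \<Delta>"
  shows "f z \<le> f u + \<Delta> powr (real q + \<sigma>) + C * (2 * \<Delta>) ^ Suc q"
proof -
  let ?T = "cutting_plane_model F orc q W"
  have W: "finite W" "W \<noteq> {}" "W \<subseteq> cball x \<Delta>"
    and sol: "model_solution F orc q W x \<Delta> z" and acc: "model_accurate F f orc q \<sigma> c W \<Delta> z"
    using subroutine_result[OF sub] \<open>\<Delta> > 0\<close> by auto
  have "?T u \<le> f u + C * (2 * \<Delta>) ^ Suc q"
  proof -
    have "taylor q (F (orc y)) u y \<le> f u + C * (2 * \<Delta>) ^ Suc q" if "y \<in> W" for y
    proof -
      have s: "orc y \<in> topspace S"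
        using orc[of y] by (simp add: active_set_def)
      have y: "y \<in> cball x \<Delta>" using that W by blast
      have "norm (u - y) \<le> 2 * \<Delta>"
        using u y dist_triangle[of u y x] by (simp add: dist_norm norm_minus_commute)
      then have "C * norm (u - y) ^ Suc q \<le> C * (2 * \<Delta>) ^ Suc q"
        using \<open>C \<ge> 0\<close> by (intro mult_left_mono power_mono) auto
      moreover have "F (orc y) u \<le> f u"
        using rep s by (simp add: max_representation_def)
      ultimately show ?thesis
        using C[OF s y u] by linarith
    qed
    then show ?thesis
      using W by (simp add: cutting_plane_model_def)
  qed
  moreover have "?T z \<le> ?T u"
    using sol u by (auto simp: model_solution_def is_arg_min_linorder)
  moreover have "f z - ?T z \<le> \<Delta> powr (real q + \<sigma>)"
    using acc by (simp add: model_accurate_def)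
  ultimately show ?thesis by linarith
qed

section \<open>Descent and termination of the inner loops\<close>

lemma inner_loop_descent:
  assumes run: "trust_region_bundle_run F f orc q p \<sigma> c \<Delta> \<tau> x0 x W z"
    and "j \<ge> 1" and "\<Delta> j > 0" and "\<forall>k<i. \<not> break_at f p \<Delta> \<tau> x z j k"
  shows "f (x j i) \<le> f (x j 0) - real i * (\<tau> j * \<Delta> j ^ p)"
  using assms(4)
proof (induction i)
  case (Suc i)
  then have nb: "\<not> break_at f p \<Delta> \<tau> x z j i" and "\<forall>k<i. \<not> break_at f p \<Delta> \<tau> x z j k"
    by auto
  with run \<open>j \<ge> 1\<close> have "x j (Suc i) = z j i"
    unfolding trust_region_bundle_run_def by metis
  moreover have "\<tau> j * \<Delta> j ^ p \<le> f (x j i) - f (z j i)"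
    using nb \<open>\<Delta> j > 0\<close> by (simp add: break_at_def not_less pos_le_divide_eq)
  ultimately show ?case
    using Suc by (simp add: algebra_simps)
qed simp

text \<open>An inner loop without break would push \<open>f\<close> down by at least \<open>\<tau>\<^sub>j \<Delta>\<^sub>j\<^sup>p\<close> in every step.\<close>

lemma inner_loop_breaks:
  assumes run: "trust_region_bundle_run F f orc q p \<sigma> c \<Delta> \<tau> x0 x W z"
    and j: "j \<ge> 1" and pos: "\<Delta> j > 0" "\<tau> j > 0" and bdd: "\<And>y. f y \<le> f (x j 0) \<Longrightarrow> m \<le> f y"
  shows "\<exists>i. break_at f p \<Delta> \<tau> x z j i"
proof (rule ccontr)
  assume "\<nexists>i. break_at f p \<Delta> \<tau> x z j i"
  then have desc: "f (x j i) \<le> f (x j 0) - real i * (\<tau> j * \<Delta> j ^ p)" for i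
    using inner_loop_descent[where f = f, OF run j pos(1)] by blast
  have step: "\<tau> j * \<Delta> j ^ p > 0" using pos by simp
  obtain i where i: "f (x j 0) - m < real i * (\<tau> j * \<Delta> j ^ p)"
    using reals_Archimedean3[OF step] by blast
  have "f (x j i) \<le> f (x j 0)"
    using desc[of i] step by (smt (verit) mult_nonneg_nonneg of_nat_0_le_iff)
  then have "m \<le> f (x j i)" by (rule bdd)
  then show False using desc[of i] i by linarith
qed

lemma outer_iterates:
  assumes run: "trust_region_bundle_run F f orc q p \<sigma> c \<Delta> \<tau> x0 x W z"
    and pos: "\<And>j. j \<ge> 1 \<Longrightarrow> \<Delta> j > 0" "\<And>j. j \<ge> 1 \<Longrightarrow> \<tau> j > 0"
    and bdd: "\<And>y. f y \<le> f x0 \<Longrightarrow> m \<le> f y" and j: "j \<ge> 1"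
  defines "l \<equiv> last_index f p \<Delta> \<tau> x z"
  shows "break_at f p \<Delta> \<tau> x z j (l j)"
    and "subroutine F f orc q \<sigma> c (x j (l j)) (\<Delta> j) {x j (l j)} (W j (l j)) (z j (l j))"
    and "f (x j (l j)) \<le> f x0"
proof -
  have advance: "break_at f p \<Delta> \<tau> x z j (l j) \<and> f (x j (l j)) \<le> f x0 \<and>
      subroutine F f orc q \<sigma> c (x j (l j)) (\<Delta> j) {x j (l j)} (W j (l j)) (z j (l j)) \<and>
      x (Suc j) 0 = x j (l j)"
    if j: "j \<ge> 1" and start: "f (x j 0) \<le> f x0" for j
  proof -
    have "\<exists>i. break_at f p \<Delta> \<tau> x z j i"
      using inner_loop_breaks[where f = f, OF run j pos[OF j]] bdd start order_trans by blast
    then have br: "break_at f p \<Delta> \<tau> x z j (l j)"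
      unfolding l_def last_index_def by (rule LeastI_ex)
    have nb: "\<forall>k<l j. \<not> break_at f p \<Delta> \<tau> x z j k"
      unfolding l_def last_index_def using not_less_Least by blast
    have "f (x j (l j)) \<le> f (x j 0) - real (l j) * (\<tau> j * \<Delta> j ^ p)"
      by (rule inner_loop_descent[where f = f, OF run j pos(1)[OF j] nb])
    also have "\<dots> \<le> f (x j 0)"
      using pos[OF j] by simp
    finally show ?thesis
      using run j nb br start unfolding trust_region_bundle_run_def by (metis order_trans)
  qed
  have "f (x j 0) \<le> f x0"
    using j
  proof (induction j rule: dec_induct)
    case base
    then show ?case using run by (simp add: trust_region_bundle_run_def)
  next
    case (step n)
    then show ?case using advance[of n] by simp
  qed
  from advance[OF j this] show "break_at f p \<Delta> \<tau> x z j (l j)"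
    and "subroutine F f orc q \<sigma> c (x j (l j)) (\<Delta> j) {x j (l j)} (W j (l j)) (z j (l j))"
    and "f (x j (l j)) \<le> f x0" by blast+
qed

section \<open>Criticality of accumulation points\<close>

text \<open>At a non-critical \<open>l\<close> some direction \<open>v\<close> has negative Clarke derivative. Since that derivative
  is an upper limit over base points near \<open>l\<close>, the same rate of decrease is available at
  all points close to \<open>l\<close>, so on a small ball of radius \<open>\<delta>\<close> around such a point \<open>f\<close> drops by
  at least a fixed multiple of \<open>\<delta>\<close>.\<close>

lemma critical_point_if_decrease_vanishes:
  fixes f :: "real^'n::finite \<Rightarrow> real"
  assumes y: "y \<longlonglongrightarrow> l" and \<delta>: "\<delta> \<longlonglongrightarrow> 0" "\<forall>\<^sub>F k in sequentially. \<delta> k > 0"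
    and ratio: "r \<longlonglongrightarrow> 0" and r: "\<forall>\<^sub>F k in sequentially. \<forall>u\<in>cball (y k) (\<delta> k). f (y k) - f u \<le> r k * \<delta> k"
  shows "critical_point f l"
proof (rule ccontr)
  assume "\<not> critical_point f l"
  then obtain v where "clarke_dir_deriv f l v < 0"
    by (auto simp: critical_point_def clarke_subdifferential_def not_le zero_ereal_def)
  then obtain b where b: "clarke_dir_deriv f l v < ereal b" "b < 0"
    using ereal_dense2[of "clarke_dir_deriv f l v" 0] by auto
  \<comment> \<open>The summand \<open>1\<close> spares a case distinction on \<open>v = 0\<close>.\<close>
  define t where "t k = \<delta> k / (norm v + 1)" for k
  have nv: "norm v + 1 > 0" by (simp add: add_nonneg_pos)
  have "t \<longlonglongrightarrow> 0"
    unfolding t_def using tendsto_divide[OF \<delta>(1) tendsto_const[of "norm v + 1"]] nv by simp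
  moreover have tpos: "\<forall>\<^sub>F k in sequentially. t k > 0"
    using \<delta>(2) by eventually_elim (use nv in \<open>simp add: t_def\<close>)
  ultimately have "filterlim t (at_right 0) sequentially"
    by (auto simp: filterlim_at elim: eventually_mono)
  then have lim: "filterlim (\<lambda>k. (y k, t k)) (nhds l \<times>\<^sub>F at_right 0) sequentially"
    using y by (intro filterlim_Pair)
  have "\<forall>\<^sub>F w in nhds l \<times>\<^sub>F at_right 0. (case w of (y, t) \<Rightarrow> ereal ((f (y + t *\<^sub>R v) - f y) / t)) < b"
    using Limsup_lessD[OF b(1)[unfolded clarke_dir_deriv_def]] .
  with lim have "\<forall>\<^sub>F k in sequentially. (f (y k + t k *\<^sub>R v) - f (y k)) / t k < b"
    by (auto simp: filterlim_iff)
  then have "\<forall>\<^sub>F k in sequentially. - b / (norm v + 1) \<le> r k"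
    using tpos r \<delta>(2)
  proof eventually_elim
    case (elim k)
    have "norm (t k *\<^sub>R v) = \<delta> k * (norm v / (norm v + 1))"
      using elim(4) nv by (simp add: t_def)
    also have "\<dots> \<le> \<delta> k"
      using elim(4) nv by (intro mult_left_le) (auto simp: divide_le_eq)
    finally have "y k + t k *\<^sub>R v \<in> cball (y k) (\<delta> k)"
      by (simp add: dist_norm)
    with elim(3) have "f (y k) - f (y k + t k *\<^sub>R v) \<le> r k * \<delta> k" by blast
    moreover have "f (y k + t k *\<^sub>R v) - f (y k) < b * t k"
      using elim(1,2) by (simp add: pos_divide_less_eq)
    ultimately have "- b * t k \<le> r k * \<delta> k" by linarith
    then have "(- b / (norm v + 1)) * \<delta> k \<le> r k * \<delta> k"
      by (simp add: t_def)
    then show ?case using elim(4) by (simp only: mult_le_cancel_right_pos)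
  qed
  then have "- b / (norm v + 1) \<le> 0"
    using ratio tendsto_lowerbound trivial_limit_sequentially by blast
  then show False
    using divide_neg_pos[OF b(2) nv] by simp
qed

section \<open>Convergence of the method\<close>

theorem theorem3p1:
  fixes S :: "'s topology" and F :: "'s \<Rightarrow> real^'n::finite \<Rightarrow> real" and f :: "real^'n \<Rightarrow> real"
    and orc :: "real^'n \<Rightarrow> 's" and q p :: nat and \<sigma> c :: real and \<Delta> \<tau> :: "nat \<Rightarrow> real"
    and x0 :: "real^'n" and x z :: "nat \<Rightarrow> nat \<Rightarrow> real^'n" and W :: "nat \<Rightarrow> nat \<Rightarrow> (real^'n) set"
    and X :: "nat \<Rightarrow> real^'n"
  assumes "p \<ge> 1" and "q \<ge> 1" and "q \<ge> p"
    and "max_representation q S F f"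
    and "\<And>y. orc y \<in> active_set S F f y"
    and "bounded {y. f y \<le> f x0}"
    and "\<And>j. j \<ge> 1 \<Longrightarrow> \<Delta> j > 0" and "\<Delta> \<longlonglongrightarrow> 0"
    and "\<And>j. j \<ge> 1 \<Longrightarrow> \<tau> j > 0" and "\<tau> \<longlonglongrightarrow> 0"
    and "0 < \<sigma>" and "\<sigma> < 1" and "c > 0"
    and "trust_region_bundle_run F f orc q p \<sigma> c \<Delta> \<tau> x0 x W z"
    and "\<And>j. j \<ge> 1 \<Longrightarrow> X j = x j (last_index f p \<Delta> \<tau> x z j)"
  shows "(\<forall>j\<ge>1. \<exists>i. break_at f p \<Delta> \<tau> x z j i)
    \<and> (\<lambda>j. Lambda f p (X j) (\<Delta> j)) \<longlonglongrightarrow> 0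
    \<and> (\<exists>l. accumulation_point X l)
    \<and> (\<forall>l. accumulation_point X l \<longrightarrow> critical_point f l)"
proof -
  note rep = assms(4) and orc = assms(5) and \<Delta>_pos = assms(7) and \<tau>_pos = assms(9)
    and run = assms(14) and X = assms(15)
  define L where "L = {y. f y \<le> f x0}"
  define V where "V j = arg_min_on f (cball (X j) (\<Delta> j))" for j
  have cont: "continuous_on A f" for A
    using max_representation_continuous[OF rep] continuous_on_subset by blast
  have "compact L"
    unfolding compact_eq_bounded_closed L_def
    using assms(6) cont[of UNIV] by (auto intro: closed_Collect_le continuous_on_const)
  moreover have "x0 \<in> L" by (simp add: L_def)
  ultimately obtain m where m: "\<And>y. f y \<le> f x0 \<Longrightarrow> m \<le> f y"
    using continuous_attains_inf[of L f] cont by (auto simp: L_def)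
  define i where "i = last_index f p \<Delta> \<tau> x z"
  have outer: "break_at f p \<Delta> \<tau> x z j (i j)"
    "subroutine F f orc q \<sigma> c (X j) (\<Delta> j) {X j} (W j (i j)) (z j (i j))" "f (X j) \<le> f x0"
    and X_eq: "X j = x j (i j)" if "j \<ge> 1" for j
    using outer_iterates[where f = f and j = j and m = m, OF run _ _ _ that] \<Delta>_pos \<tau>_pos m that
    by (simp_all add: X i_def)
  have X_L: "X j \<in> L" if "j \<ge> 1" for j
    using outer(3)[OF that] by (simp add: L_def)
  have V: "V j \<in> cball (X j) (\<Delta> j)" "\<And>u. u \<in> cball (X j) (\<Delta> j) \<Longrightarrow> f (V j) \<le> f u"
    if "j \<ge> 1" for j
    unfolding V_def using \<Delta>_pos[OF that] cont
    by (auto intro!: arg_min_on_compact simp del: mem_cball)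

  have breaks: "\<forall>j\<ge>1. \<exists>i. break_at f p \<Delta> \<tau> x z j i"
    using outer(1) by blast

  obtain R where R: "\<And>y. y \<in> L \<Longrightarrow> norm y \<le> R"
    using compact_imp_bounded[OF \<open>compact L\<close>] by (auto simp: bounded_iff)
  obtain D where D: "\<And>j. \<Delta> j \<le> D"
    using convergent_imp_Bseq[OF convergentI[OF assms(8)]] by (auto simp: Bseq_def abs_le_iff)
  obtain C where "C \<ge> 0" and C: "\<And>s y u. s \<in> topspace S \<Longrightarrow> y \<in> cball 0 (R + D) \<Longrightarrow> u \<in> cball 0 (R + D)
      \<Longrightarrow> \<bar>F s u - taylor q (F s) u y\<bar> \<le> C * norm (u - y) ^ Suc q"
    using uniform_taylor_error[OF rep order_refl] by metis
  define e where "e j = \<tau> j + \<Delta> j powr (real (q - p) + \<sigma>) + C * 2 ^ Suc q * \<Delta> j ^ Suc (q - p)" for j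
  have upper: "Lambda f p (X j) (\<Delta> j) \<le> e j" if j: "j \<ge> 1" for j
  proof -
    have pos: "\<Delta> j > 0" using \<Delta>_pos[OF j] .
    have "cball (X j) (\<Delta> j) \<subseteq> cball 0 (R + D)"
    proof
      fix u assume "u \<in> cball (X j) (\<Delta> j)"
      then have "norm (u - X j) \<le> D"
        using D[of j] by (simp add: dist_norm norm_minus_commute)
      then show "u \<in> cball 0 (R + D)"
        using norm_triangle_sub[of u "X j"] R[OF X_L[OF j]] by simp
    qed
    with C have "\<bar>F s u - taylor q (F s) u y\<bar> \<le> C * norm (u - y) ^ Suc q"
      if "s \<in> topspace S" "y \<in> cball (X j) (\<Delta> j)" "u \<in> cball (X j) (\<Delta> j)" for s y u
      using that by blast
    then have "f (z j (i j)) \<le> f (V j) + \<Delta> j powr (real q + \<sigma>) + C * (2 * \<Delta> j) ^ Suc q"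
      using outer(2)[OF j] V(1)[OF j] \<open>C \<ge> 0\<close> pos
      by (intro subroutine_nearly_minimizes[OF rep orc])
    moreover have "f (X j) - f (z j (i j)) \<le> \<tau> j * \<Delta> j ^ p"
      using outer(1)[OF j] pos by (simp add: break_at_def X_eq[OF j] pos_divide_less_eq)
    moreover have "\<Delta> j powr (real q + \<sigma>) = \<Delta> j powr (real (q - p) + \<sigma>) * \<Delta> j ^ p"
      using pos \<open>q \<ge> p\<close> by (simp add: powr_realpow[symmetric] powr_add[symmetric] of_nat_diff)
    moreover have "\<Delta> j ^ Suc q = \<Delta> j ^ Suc (q - p) * \<Delta> j ^ p"
      using \<open>q \<ge> p\<close> by (simp flip: power_add)
    then have "C * (2 * \<Delta> j) ^ Suc q = C * 2 ^ Suc q * \<Delta> j ^ Suc (q - p) * \<Delta> j ^ p"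
      by (simp only: power_mult_distrib mult.assoc)
    ultimately have "f (X j) - f (V j) \<le> e j * \<Delta> j ^ p"
      unfolding e_def by (simp only: distrib_right)
    then show ?thesis
      using pos by (simp add: Lambda_def V_def pos_divide_le_eq)
  qed
  have lower: "0 \<le> Lambda f p (X j) (\<Delta> j)" if "j \<ge> 1" for j
    using V(2)[OF that, of "X j"] \<Delta>_pos[OF that] by (simp add: Lambda_def V_def)
  have "(\<lambda>j. \<Delta> j powr (real (q - p) + \<sigma>)) \<longlonglongrightarrow> 0"
    using \<Delta>_pos \<open>0 < \<sigma>\<close>
    by (intro tendsto_zero_powrI[OF assms(8) tendsto_const])
       (auto simp: eventually_sequentially intro!: exI[of _ 1] less_imp_le)
  moreover have "(\<lambda>j. \<Delta> j ^ Suc (q - p)) \<longlonglongrightarrow> 0"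
    using tendsto_power[OF assms(8), of "Suc (q - p)"] by simp
  ultimately have "(\<lambda>j. e j) \<longlonglongrightarrow> 0 + 0 + C * 2 ^ Suc q * 0"
    unfolding e_def using assms(10) by (intro tendsto_intros)
  then have e0: "e \<longlonglongrightarrow> 0" by simp
  have Lam: "(\<lambda>j. Lambda f p (X j) (\<Delta> j)) \<longlonglongrightarrow> 0"
    by (rule tendsto_sandwich[OF _ _ tendsto_const e0])
       (auto simp: eventually_sequentially intro!: exI[of _ 1] lower upper)

  have "\<exists>l. accumulation_point X l"
  proof -
    \<comment> \<open>The shift discards the value at index \<open>0\<close>, which the method does not determine.\<close>
    have "\<forall>j. X (Suc j) \<in> L" using X_L by simp
    then obtain l r where r: "strict_mono r" "((\<lambda>j. X (Suc j)) \<circ> r) \<longlonglongrightarrow> l"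
      using \<open>compact L\<close> unfolding compact_def by metis
    then have "strict_mono (Suc \<circ> r)" "(X \<circ> (Suc \<circ> r)) \<longlonglongrightarrow> l"
      by (auto simp: strict_mono_def o_def)
    then show ?thesis
      unfolding accumulation_point_def by blast
  qed

  moreover have "critical_point f l" if acc: "accumulation_point X l" for l
  proof -
    obtain r where r: "strict_mono r" "(X \<circ> r) \<longlonglongrightarrow> l"
      using acc by (auto simp: accumulation_point_def)
    \<comment> \<open>Passing from exponent \<open>p\<close> to exponent \<open>1\<close> costs a factor \<open>\<Delta>\<^sup>p\<^sup>-\<^sup>1\<close>, which stays bounded.\<close>
    define \<rho> where "\<rho> j = Lambda f p (X j) (\<Delta> j) * \<Delta> j ^ (p - 1)" for j
    have \<rho>: "f (X j) - f u \<le> \<rho> j * \<Delta> j" if "j \<ge> 1" "u \<in> cball (X j) (\<Delta> j)" for j u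
    proof -
      have "\<rho> j * \<Delta> j = Lambda f p (X j) (\<Delta> j) * \<Delta> j ^ p"
        using power_minus_mult[of p "\<Delta> j"] \<open>p \<ge> 1\<close> by (simp add: \<rho>_def mult.assoc)
      also have "\<dots> = f (X j) - f (V j)"
        using \<Delta>_pos[OF that(1)] by (simp add: Lambda_def V_def)
      finally show ?thesis using V(2)[OF that] by linarith
    qed
    have ge1: "\<forall>\<^sub>F k in sequentially. r k \<ge> 1"
      using filterlim_subseq[OF r(1)] by (simp add: filterlim_at_top)
    have "\<rho> \<longlonglongrightarrow> 0 * 0 ^ (p - 1)"
      unfolding \<rho>_def by (intro tendsto_intros Lam assms(8))
    then have "(\<rho> \<circ> r) \<longlonglongrightarrow> 0"
      using LIMSEQ_subseq_LIMSEQ r(1) by fastforce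
    moreover have "(\<Delta> \<circ> r) \<longlonglongrightarrow> 0"
      using LIMSEQ_subseq_LIMSEQ assms(8) r(1) by blast
    moreover have "\<forall>\<^sub>F k in sequentially. (\<Delta> \<circ> r) k > 0"
      using ge1 by eventually_elim (simp add: \<Delta>_pos)
    moreover have "\<forall>\<^sub>F k in sequentially. \<forall>u\<in>cball ((X \<circ> r) k) ((\<Delta> \<circ> r) k).
        f ((X \<circ> r) k) - f u \<le> (\<rho> \<circ> r) k * (\<Delta> \<circ> r) k"
      using ge1 by eventually_elim (use \<rho> in auto)
    ultimately show ?thesis
      using r(2) by (intro critical_point_if_decrease_vanishes)
  qed
  ultimately show ?thesis using breaks Lam by blast
qed

end
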